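(* For every $\epsilon>0$ there exists $k=\Theta(1/\epsilon^2)$ and an XOS function $f:\{0,1\}^k\to[0,1]$ such that $\mathsf{deg}^{\ell_2}_\epsilon(f)=\Omega(1/\epsilon)$.
   Context: $f$ is XOS if $f(x)=\max_{c\in C}\sum_{i=1}^k w_{ci}x_i$ for a nonempty finite set $C$ and weights $w_{ci}\ge0$. $\mathsf{deg}^{\ell_2}_\epsilon(f)$ is the smallest $d$ such that some real polynomial $p$ of degree $d$ satisfies $\|f-p\|_2=\sqrt{\mathbb{E}_x[(f(x)-p(x))^2]}\le\epsilon$, with $x$ uniform on $\{0,1\}^k$. Implied constants are absolute.
   Formalization: Stated for 0 < ε < 1/2 only: for ε ≥ 1/2 the constant 1/2 approximates every f with values in [0,1] within ε, so the degree is 0 and the bound Ω(1/ε) with an absolute constant fails. *)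

theory Defs
  imports
    "HOL-Probability.Probability_Mass_Function"
    "HOL-Library.Poly_Mapping"
begin

definition cube :: "nat \<Rightarrow> (nat \<Rightarrow> real) set" where
  "cube k = ({..<k} \<rightarrow>\<^sub>E {0, 1})"

definition xos :: "nat \<Rightarrow> ((nat \<Rightarrow> real) \<Rightarrow> real) \<Rightarrow> bool" where
  "xos k f \<longleftrightarrow>
     (\<exists>(C :: nat set) (w :: nat \<Rightarrow> nat \<Rightarrow> real).
        finite C \<and> C \<noteq> {} \<and> (\<forall>c\<in>C. \<forall>i<k. w c i \<ge> 0) \<and>
        (\<forall>x\<in>cube k. f x = Max ((\<lambda>c. \<Sum>i<k. w c i * x i) ` C)))"

text \<open>Real polynomials: a monomial is a finitely supported exponent map, a polynomial a
  finitely supported coefficient map on monomials.\<close>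

type_synonym real_mpoly = "(nat \<Rightarrow>\<^sub>0 nat) \<Rightarrow>\<^sub>0 real"

definition mpoly_vars :: "real_mpoly \<Rightarrow> nat set" where
  "mpoly_vars p = (\<Union>m\<in>Poly_Mapping.keys p. Poly_Mapping.keys m)"

definition monom_degree :: "(nat \<Rightarrow>\<^sub>0 nat) \<Rightarrow> nat" where
  "monom_degree m = (\<Sum>i\<in>Poly_Mapping.keys m. Poly_Mapping.lookup m i)"

text \<open>Total degree; the zero polynomial gets degree 0.\<close>

definition mpoly_degree :: "real_mpoly \<Rightarrow> nat" where
  "mpoly_degree p = Max (insert 0 (monom_degree ` Poly_Mapping.keys p))"

definition mpoly_eval :: "real_mpoly \<Rightarrow> (nat \<Rightarrow> real) \<Rightarrow> real" where
  "mpoly_eval p x =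
     (\<Sum>m\<in>Poly_Mapping.keys p.
        Poly_Mapping.lookup p m * (\<Prod>i\<in>Poly_Mapping.keys m. x i ^ Poly_Mapping.lookup m i))"

definition l2_dist :: "nat \<Rightarrow> ((nat \<Rightarrow> real) \<Rightarrow> real) \<Rightarrow> ((nat \<Rightarrow> real) \<Rightarrow> real) \<Rightarrow> real" where
  "l2_dist k f g =
     sqrt (measure_pmf.expectation (pmf_of_set (cube k)) (\<lambda>x. (f x - g x)\<^sup>2))"

text \<open>For \<open>\<epsilon> \<ge> 0\<close> the minimum is over a nonempty set, since every function on the cube agrees
  there with a polynomial (multilinear interpolation).\<close>

definition l2_degree :: "nat \<Rightarrow> real \<Rightarrow> ((nat \<Rightarrow> real) \<Rightarrow> real) \<Rightarrow> nat" where
  "l2_degree k \<epsilon> f =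
     (LEAST d. \<exists>p. mpoly_vars p \<subseteq> {..<k} \<and> mpoly_degree p = d \<and>
                   l2_dist k f (mpoly_eval p) \<le> \<epsilon>)"

end

(* Parity is an extremal obstruction: the character \<psi>(x) = (-1)^(x_1 + ... + x_n) is orthogonal to every
   polynomial of degree less than n, so a function correlating with \<psi> by more than \<epsilon> has \<epsilon>-approximate
   l2 degree at least n.  Writing s = x_1 + ... + x_n, the function n + s + (s mod 2) on x \<noteq> 0 has parity
   component of constant size, and it is still XOS: the weights proportional to a point z and exact at z
   stay below the function, because passing from z to a different point costs at least 1, which absorbs the parity bit.
   After dividing by 2n + 1 the correlation is of order 1/n, so n of order 1/\<epsilon> works; the remaining
   k - n variables are dummies.  For n = 1 the function is x_1, at distance 1/2 from the constants, which
   covers \<epsilon> close to 1/2. *)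

theory Submission
  imports Defs
begin

section \<open>Sums over the cube\<close>

lemma finite_cube [simp]: "finite (cube k)"
  by (simp add: cube_def finite_PiE)

lemma card_cube: "card (cube k) = 2 ^ k"
  by (simp add: cube_def card_PiE numeral_2_eq_2)

lemma cube_nonempty [simp]: "cube k \<noteq> {}"
  using card_cube[of k] by force

lemma cube_cases: "x \<in> cube k \<Longrightarrow> i < k \<Longrightarrow> x i = 0 \<or> x i = 1"
  by (auto simp: cube_def PiE_def Pi_def)

lemma expectation_cube:
  "measure_pmf.expectation (pmf_of_set (cube k)) g = (\<Sum>x\<in>cube k. g x) / 2 ^ k" for g :: "_ \<Rightarrow> real"
  by (simp add: integral_pmf_of_set card_cube)

lemma flip_in_cube: "x \<in> cube k \<Longrightarrow> i < k \<Longrightarrow> x(i := 1 - x i) \<in> cube k"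
  by (auto simp: cube_def PiE_def Pi_def extensional_def)

section \<open>The parity character of the first \<open>n\<close> coordinates\<close>

definition char_fn :: "nat \<Rightarrow> (nat \<Rightarrow> real) \<Rightarrow> real" where
  "char_fn n x = (\<Prod>i<n. 1 - 2 * x i)"

lemma char_fn_flip:
  assumes "i < n"
  shows "char_fn n (x(i := 1 - x i)) = - char_fn n x"
proof -
  have split: "char_fn n y = (1 - 2 * y i) * (\<Prod>j\<in>{..<n} - {i}. 1 - 2 * y j)" for y
    unfolding char_fn_def using assms by (subst prod.remove[of _ i]) auto
  have "(\<Prod>j\<in>{..<n} - {i}. 1 - 2 * (x(i := 1 - x i)) j) = (\<Prod>j\<in>{..<n} - {i}. 1 - 2 * x j)"
    by (intro prod.cong) auto
  then show ?thesis
    unfolding split[of x] split[of "x(i := 1 - x i)"] by (simp flip: mult_minus_left)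
qed

text \<open>Flipping coordinate \<open>i\<close> is an involution of the cube that preserves
  \<open>g\<close> and negates the character, so the sum equals its own negative. Every
  orthogonality relation below comes from this.\<close>

lemma sum_char_fn_flip_invariant:
  assumes "i < n" "n \<le> k" and inv: "\<And>x. x \<in> cube k \<Longrightarrow> g (x(i := 1 - x i)) = g x"
  shows "(\<Sum>x\<in>cube k. g x * char_fn n x) = 0"
proof -
  have "(\<Sum>x\<in>cube k. g x * char_fn n x)
      = (\<Sum>x\<in>cube k. g (x(i := 1 - x i)) * char_fn n (x(i := 1 - x i)))"
    by (rule sum.reindex_bij_witness[where i = "\<lambda>x. x(i := 1 - x i)" and j = "\<lambda>x. x(i := 1 - x i)"])
       (use assms in \<open>auto intro!: flip_in_cube\<close>)
  also have "\<dots> = - (\<Sum>x\<in>cube k. g x * char_fn n x)"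
    using assms by (simp add: char_fn_flip inv sum_negf)
  finally show ?thesis by simp
qed

lemma char_fn_squared:
  assumes "x \<in> cube k" "n \<le> k"
  shows "char_fn n x * char_fn n x = 1"
proof -
  have "(1 - 2 * x i) * (1 - 2 * x i) = 1" if "i < n" for i
    using cube_cases[OF assms(1), of i] assms(2) that by auto
  then show ?thesis by (simp add: char_fn_def flip: prod.distrib)
qed

section \<open>Polynomials on the cube\<close>

text \<open>A summation range shared by several polynomials makes evaluation additive, even where
  cancellation shrinks the key set of a sum.\<close>

lemma mpoly_eval_superset:
  assumes "finite A" "Poly_Mapping.keys p \<subseteq> A"
  shows "mpoly_eval p x =
    (\<Sum>m\<in>A. Poly_Mapping.lookup p m * (\<Prod>i\<in>Poly_Mapping.keys m. x i ^ Poly_Mapping.lookup m i))"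
  unfolding mpoly_eval_def
  by (rule sum.mono_neutral_left) (use assms in \<open>auto simp: in_keys_iff\<close>)

lemma mpoly_eval_0 [simp]: "mpoly_eval 0 x = 0"
  by (simp add: mpoly_eval_def)

lemma mpoly_eval_add: "mpoly_eval (p + q) x = mpoly_eval p x + mpoly_eval q x"
proof -
  let ?A = "Poly_Mapping.keys p \<union> Poly_Mapping.keys q"
  have "Poly_Mapping.keys (p + q) \<subseteq> ?A"
    by (rule Poly_Mapping.keys_add)
  then show ?thesis
    by (simp add: mpoly_eval_superset[of ?A] lookup_add distrib_right sum.distrib)
qed

lemma mpoly_eval_sum: "mpoly_eval (sum p A) x = (\<Sum>a\<in>A. mpoly_eval (p a) x)"
  by (induction A rule: infinite_finite_induct) (auto simp: mpoly_eval_add)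

lemma mpoly_eval_single:
  "mpoly_eval (Poly_Mapping.single m c) x =
    c * (\<Prod>i\<in>Poly_Mapping.keys m. x i ^ Poly_Mapping.lookup m i)"
  by (simp add: mpoly_eval_superset[of "{m}"])

lemma mpoly_vars_sum:
  assumes "\<And>a. a \<in> A \<Longrightarrow> mpoly_vars (p a) \<subseteq> V"
  shows "mpoly_vars (sum p A) \<subseteq> V"
  using assms
proof (induction A rule: infinite_finite_induct)
  case (insert a A)
  have "mpoly_vars (p a + sum p A) \<subseteq> mpoly_vars (p a) \<union> mpoly_vars (sum p A)"
    using Poly_Mapping.keys_add[of "p a" "sum p A"] by (auto simp: mpoly_vars_def)
  with insert show ?case by fastforce
qed (auto simp: mpoly_vars_def)

section \<open>Multilinear interpolation on the cube\<close>

lemma multilinear_mpoly: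
  "\<exists>p. mpoly_vars p \<subseteq> {..<k} \<and> (\<forall>x. mpoly_eval p x = (\<Sum>S\<in>Pow {..<k}. a S * (\<Prod>i\<in>S. x i)))"
proof -
  \<comment> \<open>The exponent map of the squarefree monomial of \<open>S\<close> is the indicator
    function of \<open>S\<close>.\<close>
  have "\<exists>m :: nat \<Rightarrow>\<^sub>0 nat. Poly_Mapping.keys m = S \<and> (\<forall>i\<in>S. Poly_Mapping.lookup m i = 1)"
    if "finite S" for S :: "nat set"
  proof -
    have fin: "finite {i. (if i \<in> S then 1 else 0 :: nat) \<noteq> 0}" using that by auto
    have lk: "Poly_Mapping.lookup (Abs_poly_mapping (\<lambda>i. if i \<in> S then 1 else 0 :: nat))
        = (\<lambda>i. if i \<in> S then 1 else 0)"
      by (rule Abs_poly_mapping_inverse) (use fin in simp)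
    show ?thesis
      by (rule exI[of _ "Abs_poly_mapping (\<lambda>i. if i \<in> S then 1 else 0)"])
         (auto simp: lk in_keys_iff split: if_splits)
  qed
  then obtain m :: "nat set \<Rightarrow> nat \<Rightarrow>\<^sub>0 nat" where
    m: "\<And>S. finite S \<Longrightarrow> Poly_Mapping.keys (m S) = S"
       "\<And>S i. finite S \<Longrightarrow> i \<in> S \<Longrightarrow> Poly_Mapping.lookup (m S) i = 1"
    by metis
  define p where "p = (\<Sum>S\<in>Pow {..<k}. Poly_Mapping.single (m S) (a S))"
  have fin: "finite S" if "S \<in> Pow {..<k}" for S
    using that finite_subset by blast
  have "mpoly_eval p x = (\<Sum>S\<in>Pow {..<k}. a S * (\<Prod>i\<in>S. x i))" for x
    unfolding p_def mpoly_eval_sum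
    by (intro sum.cong refl) (simp add: mpoly_eval_single m fin)
  moreover have "mpoly_vars p \<subseteq> {..<k}"
    unfolding p_def
  proof (rule mpoly_vars_sum)
    fix S assume S: "S \<in> Pow {..<k}"
    have "mpoly_vars (Poly_Mapping.single (m S) (a S)) \<subseteq> S"
      by (simp add: mpoly_vars_def m(1)[OF fin[OF S]])
    with S show "mpoly_vars (Poly_Mapping.single (m S) (a S)) \<subseteq> {..<k}" by auto
  qed
  ultimately show ?thesis by blast
qed

text \<open>Coordinates from \<open>k\<close> on are frozen at \<open>z\<close>. In the induction
  step, fixing coordinate \<open>k\<close> at 0 and at 1 gives expansions A and B, and f = A + x_k
  (B - A). The point \<open>z\<close> varies because the hypothesis is used at both
  \<open>z(k := 0)\<close> and \<open>z(k := 1)\<close>.\<close>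

lemma multilinear_interpolation:
  "\<exists>a. \<forall>x. (\<forall>i<k. x i = 0 \<or> x i = 1) \<longrightarrow> (\<forall>i\<ge>k. x i = z i) \<longrightarrow>
     f x = (\<Sum>S\<in>Pow {..<k}. a S * (\<Prod>i\<in>S. x i))" for f :: "(nat \<Rightarrow> real) \<Rightarrow> real"
proof (induction k arbitrary: z)
  case 0
  show ?case
    by (rule exI[of _ "\<lambda>_. f z"]) (auto intro!: arg_cong[of _ _ f])
next
  case (Suc k)
  obtain a where a: "\<And>x. (\<forall>i<k. x i = 0 \<or> x i = 1) \<Longrightarrow> (\<forall>i\<ge>k. x i = (z(k := 0)) i) \<Longrightarrow>
     f x = (\<Sum>S\<in>Pow {..<k}. a S * (\<Prod>i\<in>S. x i))"
    using Suc[of "z(k := 0)"] by blast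
  obtain b where b: "\<And>x. (\<forall>i<k. x i = 0 \<or> x i = 1) \<Longrightarrow> (\<forall>i\<ge>k. x i = (z(k := 1)) i) \<Longrightarrow>
     f x = (\<Sum>S\<in>Pow {..<k}. b S * (\<Prod>i\<in>S. x i))"
    using Suc[of "z(k := 1)"] by blast
  \<comment> \<open>Coefficients of A + x_k (B - A): sets containing \<open>k\<close> carry B - A,
    the others carry A.\<close>
  define c where "c S = (if k \<in> S then b (S - {k}) - a (S - {k}) else a S)" for S
  have "f x = (\<Sum>S\<in>Pow {..<Suc k}. c S * (\<Prod>i\<in>S. x i))"
    if x: "\<forall>i<Suc k. x i = 0 \<or> x i = 1" "\<forall>i\<ge>Suc k. x i = z i" for x
  proof -
    have inj: "inj_on (insert k) (Pow {..<k})"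
      by (auto simp: inj_on_def)
    have "(\<Sum>S\<in>Pow {..<Suc k}. c S * (\<Prod>i\<in>S. x i))
        = (\<Sum>S\<in>Pow {..<k}. c S * (\<Prod>i\<in>S. x i)) + (\<Sum>S\<in>insert k ` Pow {..<k}. c S * (\<Prod>i\<in>S. x i))"
      unfolding lessThan_Suc Pow_insert by (rule sum.union_disjoint) auto
    also have "(\<Sum>S\<in>insert k ` Pow {..<k}. c S * (\<Prod>i\<in>S. x i))
        = (\<Sum>S\<in>Pow {..<k}. x k * ((b S - a S) * (\<Prod>i\<in>S. x i)))"
      unfolding sum.reindex[OF inj] o_def
    proof (intro sum.cong refl)
      fix S assume "S \<in> Pow {..<k}"
      then have "finite S" "k \<notin> S" using finite_subset by auto
      then show "c (insert k S) * prod x (insert k S) = x k * ((b S - a S) * prod x S)"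
        by (simp add: c_def)
    qed
    also have "(\<Sum>S\<in>Pow {..<k}. c S * (\<Prod>i\<in>S. x i)) = (\<Sum>S\<in>Pow {..<k}. a S * (\<Prod>i\<in>S. x i))"
      by (intro sum.cong refl) (auto simp: c_def)
    finally have *: "(\<Sum>S\<in>Pow {..<Suc k}. c S * (\<Prod>i\<in>S. x i))
       = (\<Sum>S\<in>Pow {..<k}. a S * (\<Prod>i\<in>S. x i)) +
         x k * ((\<Sum>S\<in>Pow {..<k}. b S * (\<Prod>i\<in>S. x i)) - (\<Sum>S\<in>Pow {..<k}. a S * (\<Prod>i\<in>S. x i)))"
      by (simp add: left_diff_distrib sum_subtractf flip: sum_distrib_left)
    have "x k = 0 \<or> x k = 1" using x by simp
    then show ?thesis
    proof
      assume "x k = 0"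
      with x have "f x = (\<Sum>S\<in>Pow {..<k}. a S * (\<Prod>i\<in>S. x i))" by (intro a) auto
      with * \<open>x k = 0\<close> show ?thesis by simp
    next
      assume "x k = 1"
      with x have "f x = (\<Sum>S\<in>Pow {..<k}. b S * (\<Prod>i\<in>S. x i))" by (intro b) auto
      with * \<open>x k = 1\<close> show ?thesis by simp
    qed
  qed
  then show ?case by blast
qed

lemma mpoly_interpolation:
  "\<exists>p. mpoly_vars p \<subseteq> {..<k} \<and> (\<forall>x\<in>cube k. mpoly_eval p x = f x)"
proof -
  \<comment> \<open>Points of \<open>cube k\<close> are extensional, so their frozen coordinates all
    have the value \<open>undefined\<close>.\<close>
  obtain a where a: "\<And>x. (\<forall>i<k. x i = 0 \<or> x i = 1) \<Longrightarrow> (\<forall>i\<ge>k. x i = undefined) \<Longrightarrow>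
     f x = (\<Sum>S\<in>Pow {..<k}. a S * (\<Prod>i\<in>S. x i))"
    using multilinear_interpolation[of k "\<lambda>_. undefined" f] by blast
  obtain p where "mpoly_vars p \<subseteq> {..<k}"
    and p: "\<And>x. mpoly_eval p x = (\<Sum>S\<in>Pow {..<k}. a S * (\<Prod>i\<in>S. x i))"
    using multilinear_mpoly[of k a] by blast
  moreover have "mpoly_eval p x = f x" if "x \<in> cube k" for x
    unfolding p using that cube_cases[OF that]
    by (intro a[symmetric]) (auto simp: cube_def PiE_def extensional_def)
  ultimately show ?thesis by blast
qed

section \<open>Parity against polynomials of low degree\<close>

lemma card_keys_le_monom_degree: "card (Poly_Mapping.keys m) \<le> monom_degree m"
proof -
  have "(\<Sum>i\<in>Poly_Mapping.keys m. 1) \<le> (\<Sum>i\<in>Poly_Mapping.keys m. Poly_Mapping.lookup m i)"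
    by (rule sum_mono) (auto simp: in_keys_iff)
  then show ?thesis by (simp add: monom_degree_def)
qed

text \<open>A monomial of degree below \<open>n\<close> involves fewer than \<open>n\<close>
  variables, so it misses some x_i with i < n and is invariant under flipping that
  coordinate.\<close>

lemma low_degree_orthogonal:
  assumes "mpoly_degree p < n" "n \<le> k"
  shows "(\<Sum>x\<in>cube k. mpoly_eval p x * char_fn n x) = 0"
proof -
  have "(\<Sum>x\<in>cube k. (\<Prod>i\<in>Poly_Mapping.keys m. x i ^ Poly_Mapping.lookup m i) * char_fn n x) = 0"
    if m: "m \<in> Poly_Mapping.keys p" for m
  proof -
    have "monom_degree m \<le> mpoly_degree p"
      unfolding mpoly_degree_def using m by (intro Max_ge) auto
    then have "card (Poly_Mapping.keys m) < card {..<n}"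
      using card_keys_le_monom_degree[of m] assms(1) by simp
    then obtain i where "i < n" "i \<notin> Poly_Mapping.keys m"
      by (metis card_mono finite_keys lessThan_iff not_le subsetI)
    then show ?thesis
      by (intro sum_char_fn_flip_invariant[of i]) (use assms in \<open>auto intro!: prod.cong\<close>)
  qed
  then have "(\<Sum>m\<in>Poly_Mapping.keys p. Poly_Mapping.lookup p m *
     (\<Sum>x\<in>cube k. (\<Prod>i\<in>Poly_Mapping.keys m. x i ^ Poly_Mapping.lookup m i) * char_fn n x)) = 0"
    by simp
  then show ?thesis
    by (simp add: mpoly_eval_def sum_distrib_right sum_distrib_left mult.assoc
        sum.swap[of _ "cube k"])
qed

text \<open>Cauchy-Schwarz against the character, whose normalized l2 norm is 1.\<close>

lemma l2_dist_ge_correlation: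
  assumes "n \<le> k"
  shows "\<bar>\<Sum>x\<in>cube k. (f x - g x) * char_fn n x\<bar> / 2 ^ k \<le> l2_dist k f g"
proof -
  have "\<bar>\<Sum>x\<in>cube k. (f x - g x) * char_fn n x\<bar>\<^sup>2
      \<le> (\<Sum>x\<in>cube k. (f x - g x)\<^sup>2) * (\<Sum>x\<in>cube k. (char_fn n x)\<^sup>2)"
    using Cauchy_Schwarz_ineq_sum[of "\<lambda>x. f x - g x" "char_fn n" "cube k"] by simp
  also have "(\<Sum>x\<in>cube k. (char_fn n x)\<^sup>2) = 2 ^ k"
    using assms by (simp add: power2_eq_square char_fn_squared card_cube)
  finally have "(\<bar>\<Sum>x\<in>cube k. (f x - g x) * char_fn n x\<bar> / 2 ^ k)\<^sup>2
      \<le> (\<Sum>x\<in>cube k. (f x - g x)\<^sup>2) / 2 ^ k"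
    by (simp add: power_divide divide_simps power2_eq_square mult_ac)
  then show ?thesis
    unfolding l2_dist_def expectation_cube by (rule real_le_rsqrt)
qed

lemma l2_degree_ge:
  assumes "n \<le> k" "0 \<le> \<epsilon>" and corr: "\<epsilon> * 2 ^ k < \<bar>\<Sum>x\<in>cube k. f x * char_fn n x\<bar>"
  shows "n \<le> l2_degree k \<epsilon> f"
proof -
  let ?P = "\<lambda>d. \<exists>p. mpoly_vars p \<subseteq> {..<k} \<and> mpoly_degree p = d \<and> l2_dist k f (mpoly_eval p) \<le> \<epsilon>"
  \<comment> \<open>Exact interpolation makes the set minimized in \<open>l2_degree\<close>
    nonempty, so \<open>LeastI\<close> yields a polynomial attaining the minimum.\<close>
  obtain q where q: "mpoly_vars q \<subseteq> {..<k}" "\<And>x. x \<in> cube k \<Longrightarrow> mpoly_eval q x = f x"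
    using mpoly_interpolation by blast
  have "l2_dist k f (mpoly_eval q) = 0"
    unfolding l2_dist_def expectation_cube by (simp add: q(2))
  then have "?P (mpoly_degree q)"
    using q(1) assms(2) by auto
  then have "?P (l2_degree k \<epsilon> f)"
    unfolding l2_degree_def by (rule LeastI)
  then obtain p where p: "mpoly_degree p = l2_degree k \<epsilon> f" "l2_dist k f (mpoly_eval p) \<le> \<epsilon>"
    by blast
  show ?thesis
  proof (rule ccontr)
    assume "\<not> n \<le> l2_degree k \<epsilon> f"
    then have "(\<Sum>x\<in>cube k. mpoly_eval p x * char_fn n x) = 0"
      using p(1) assms(1) by (intro low_degree_orthogonal) auto
    then have "\<bar>\<Sum>x\<in>cube k. f x * char_fn n x\<bar> / 2 ^ k \<le> \<epsilon>"
      using l2_dist_ge_correlation[OF assms(1), of f "mpoly_eval p"] p(2)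
      by (simp add: left_diff_distrib sum_subtractf)
    then show False using corr by (simp add: divide_simps)
  qed
qed

section \<open>The parity-perturbed XOS function\<close>

text \<open>Allows clauses to be given as a finite set of weight functions; numbering that set
  produces the natural-number indices that \<open>xos\<close> asks for.\<close>

lemma xosI:
  assumes "finite W" "W \<noteq> {}" "\<And>w i. w \<in> W \<Longrightarrow> i < k \<Longrightarrow> 0 \<le> w i"
    and "\<And>x. x \<in> cube k \<Longrightarrow> f x = Max ((\<lambda>w. \<Sum>i<k. w i * x i) ` W)"
  shows "xos k f"
proof -
  obtain e :: "nat \<Rightarrow> nat \<Rightarrow> real" and N where e: "W = e ` {i. i < N}"
    using finite_imp_nat_seg_image_inj_on[OF assms(1)] by metis
  have "(\<lambda>w. \<Sum>i<k. w i * x i) ` W = (\<lambda>c. \<Sum>i<k. e c i * x i) ` {i. i < N}" for x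
    unfolding e by (simp add: image_image)
  then show ?thesis
    unfolding xos_def using assms e
    by (intro exI[of _ "{i. i < N}"] exI[of _ e]) auto
qed

definition ones :: "nat \<Rightarrow> (nat \<Rightarrow> real) \<Rightarrow> nat set" where
  "ones n x = {i. i < n \<and> x i = 1}"

lemma finite_ones [simp]: "finite (ones n x)"
  by (simp add: ones_def)

lemma card_ones_le: "card (ones n x) \<le> n"
  using card_mono[of "{..<n}" "ones n x"] by (auto simp: ones_def)

lemma sum_inner_ones:
  assumes "x \<in> cube k" "z \<in> cube k" "n \<le> k"
  shows "(\<Sum>i<n. z i * x i) = real (card (ones n z \<inter> ones n x))"
proof -
  have "(\<Sum>i<n. z i * x i) = (\<Sum>i<n. if i \<in> ones n z \<inter> ones n x then 1 else 0)"
  proof (intro sum.cong refl)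
    fix i assume "i \<in> {..<n}"
    then show "z i * x i = (if i \<in> ones n z \<inter> ones n x then 1 else 0)"
      using cube_cases[OF assms(1), of i] cube_cases[OF assms(2), of i] assms(3)
      by (auto simp: ones_def)
  qed
  also have "\<dots> = real (card ({..<n} \<inter> (ones n z \<inter> ones n x)))"
    by (simp add: sum.If_cases Int_def conj_ac)
  also have "{..<n} \<inter> (ones n z \<inter> ones n x) = ones n z \<inter> ones n x"
    by (auto simp: ones_def)
  finally show ?thesis .
qed

lemma card_ones_eq_sum:
  assumes "x \<in> cube k" "n \<le> k"
  shows "real (card (ones n x)) = (\<Sum>i<n. x i)"
proof -
  have "(\<Sum>i<n. x i * x i) = (\<Sum>i<n. x i)"
    using cube_cases[OF assms(1)] assms(2) by (intro sum.cong) fastforce+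
  with sum_inner_ones[OF assms(1,1,2)] show ?thesis by simp
qed

lemma char_fn_ones:
  assumes "x \<in> cube k" "n \<le> k"
  shows "char_fn n x = 1 - 2 * real (card (ones n x) mod 2)"
proof -
  have "char_fn n x = (\<Prod>i<n. if i \<in> ones n x then -1 else 1)"
    unfolding char_fn_def
  proof (intro prod.cong refl)
    fix i assume "i \<in> {..<n}"
    then show "1 - 2 * x i = (if i \<in> ones n x then -1 else 1)"
      using cube_cases[OF assms(1), of i] assms(2) by (auto simp: ones_def)
  qed
  also have "\<dots> = (-1) ^ card ({..<n} \<inter> ones n x)"
    by (simp add: prod.If_cases Int_def)
  also have "{..<n} \<inter> ones n x = ones n x"
    by (auto simp: ones_def)
  finally show ?thesis
    by (cases "even (card (ones n x))") (simp_all add: odd_iff_mod_2_eq_one)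
qed

text \<open>The value at s = 0 is forced: every XOS function vanishes at the origin, whereas the
  formula would give n / (2n + 1). The denominator bounds n + s + (s mod 2), since s <= n.\<close>

definition parity_bump :: "nat \<Rightarrow> (nat \<Rightarrow> real) \<Rightarrow> real" where
  "parity_bump n x =
     (let s = card (ones n x) in if s = 0 then 0 else real (n + s + s mod 2) / real (2 * n + 1))"

lemma parity_bump_range: "parity_bump n x \<in> {0..1}"
proof -
  have "card (ones n x) + card (ones n x) mod 2 \<le> n + 1"
    using card_ones_le[of n x] by presburger
  then have "real (n + card (ones n x) + card (ones n x) mod 2) \<le> real (2 * n + 1)"
    unfolding of_nat_le_iff by linarith
  then show ?thesis by (auto simp: parity_bump_def Let_def)
qed

text \<open>Domination with denominators cleared: a clause built from a point with \<open>a\<close>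
  ones is evaluated at a point with \<open>b\<close> ones, \<open>t\<close> of them common. If t =
  a, then a <= b and s + (s mod 2) is nondecreasing in s. If t < a, the missing ones cost n (a - t)
  >= n >= t, which pays for the parity bit times \<open>t\<close>.\<close>

lemma parity_bump_exchange:
  fixes a b t n :: nat
  assumes "t \<le> a" "t \<le> b" "a \<le> n"
  shows "(n + a + a mod 2) * t \<le> (n + b + b mod 2) * a"
proof (cases "t = a")
  case True
  have "a + a mod 2 \<le> b + b mod 2"
  proof (cases "a = b")
    case ne: False
    with True assms have "a + 1 \<le> b" by simp
    moreover have "a mod 2 \<le> 1" by simp
    ultimately show ?thesis by linarith
  qed simp
  then show ?thesis using True by (simp add: mult_right_mono)
next
  case False
  with assms(1) obtain r where r: "a = t + 1 + r"
    using le_Suc_ex[of "t + 1" a] by fastforce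
  have "(n + a + a mod 2) * t \<le> (n + a + 1) * t"
    by (intro mult_right_mono) auto
  also have "\<dots> = n * t + a * t + t"
    by (simp add: algebra_simps)
  also have "\<dots> \<le> (n + t) * a"
    using assms r by (simp add: algebra_simps)
  also have "\<dots> \<le> (n + b + b mod 2) * a"
    using assms by (intro mult_right_mono) auto
  finally show ?thesis .
qed

lemma xos_parity_bump:
  assumes "1 \<le> n" "n \<le> k"
  shows "xos k (parity_bump n)"
proof -
  \<comment> \<open>The clause of \<open>z\<close> spreads the value at \<open>z\<close> evenly over
    the ones of \<open>z\<close>, so it is exact at \<open>z\<close>; the coordinates from
    \<open>n\<close> on get weight 0.\<close>
  define wt where "wt z i = (if i < n then parity_bump n z / real (card (ones n z)) * z i else 0)"
    for z :: "nat \<Rightarrow> real" and i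
  \<comment> \<open>Only points with a one among the first \<open>n\<close> coordinates give a
    clause, so the division in \<open>wt\<close> is by a positive number.\<close>
  define Z where "Z = {z \<in> cube k. ones n z \<noteq> {}}"
  have Zcube: "z \<in> cube k" if "z \<in> Z" for z using that by (simp add: Z_def)
  have val: "(\<Sum>i<k. wt z i * x i)
      = parity_bump n z / real (card (ones n z)) * real (card (ones n z \<inter> ones n x))"
    if "z \<in> Z" "x \<in> cube k" for z x
  proof -
    have "(\<Sum>i<k. wt z i * x i) = (\<Sum>i<n. wt z i * x i)"
      by (rule sum.mono_neutral_right) (use assms in \<open>auto simp: wt_def\<close>)
    also have "\<dots> = parity_bump n z / real (card (ones n z)) * (\<Sum>i<n. z i * x i)"
      by (simp add: wt_def sum_distrib_left mult.assoc)
    finally show ?thesis using sum_inner_ones[OF that(2) Zcube[OF that(1)] assms(2)] by simp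
  qed
  have upper: "(\<Sum>i<k. wt z i * x i) \<le> parity_bump n x" if z: "z \<in> Z" and x: "x \<in> cube k" for z x
  proof (cases "ones n x = {}")
    case True
    then show ?thesis by (simp add: val[OF z x] parity_bump_def)
  next
    case False
    let ?a = "card (ones n z)" and ?b = "card (ones n x)" and ?t = "card (ones n z \<inter> ones n x)"
    have pos: "0 < ?a" "0 < ?b" using z False by (auto simp: Z_def card_gt_0_iff)
    have "(n + ?a + ?a mod 2) * ?t \<le> (n + ?b + ?b mod 2) * ?a"
      by (intro parity_bump_exchange card_mono card_ones_le) auto
    then have "real (n + ?a + ?a mod 2) * real ?t \<le> real (n + ?b + ?b mod 2) * real ?a"
      by (metis of_nat_le_iff of_nat_mult)
    then have "real (n + ?a + ?a mod 2) / real ?a * real ?t \<le> real (n + ?b + ?b mod 2)"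
      using pos by (simp add: divide_simps)
    from divide_right_mono[OF this, of "real (2 * n + 1)"] show ?thesis
      unfolding val[OF z x] parity_bump_def Let_def using pos by (simp add: mult_ac)
  qed
  \<comment> \<open>The all-ones point has a one among the first \<open>n\<close> coordinates
    because n >= 1.\<close>
  have "(\<lambda>i\<in>{..<k}. 1) \<in> Z"
    using assms by (auto simp: Z_def cube_def ones_def intro!: exI[of _ 0])
  then have Z0: "Z \<noteq> {}" by blast
  have finZ: "finite Z" by (simp add: Z_def)
  show ?thesis
  proof (rule xosI[of "wt ` Z"])
    fix w i assume "w \<in> wt ` Z" "i < k"
    then obtain z where z: "z \<in> Z" "w = wt z" by blast
    have "0 \<le> parity_bump n z" using parity_bump_range[of n z] by simp
    then show "0 \<le> w i"
      using cube_cases[OF Zcube[OF z(1)] \<open>i < k\<close>] by (auto simp: z(2) wt_def)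
  next
    fix x assume x: "x \<in> cube k"
    \<comment> \<open>The bound \<open>upper\<close> is attained by the clause of \<open>x\<close>
      itself; if \<open>x\<close> has no ones among the first \<open>n\<close> coordinates, every
      clause gives 0.\<close>
    have "\<exists>z\<in>Z. (\<Sum>i<k. wt z i * x i) = parity_bump n x"
    proof (cases "ones n x = {}")
      case True
      then show ?thesis using Z0 val[OF _ x] by (auto simp: parity_bump_def)
    next
      case False
      then have "x \<in> Z" using x by (simp add: Z_def)
      then show ?thesis using val[OF _ x, of x] False by (intro bexI[of _ x]) auto
    qed
    then have "parity_bump n x \<in> (\<lambda>w. \<Sum>i<k. w i * x i) ` wt ` Z"
      by (auto simp: image_image intro: rev_image_eqI)
    then show "parity_bump n x = Max ((\<lambda>w. \<Sum>i<k. w i * x i) ` wt ` Z)"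
      using finZ upper[OF _ x] by (intro Max_eqI[symmetric]) auto
  qed (use finZ Z0 in auto)
qed

section \<open>Correlation of the function with parity\<close>

lemma sum_char_fn:
  assumes "1 \<le> n" "n \<le> k"
  shows "(\<Sum>x\<in>cube k. char_fn n x) = 0"
  using sum_char_fn_flip_invariant[of 0 n k "\<lambda>_. 1"] assms by simp

text \<open>For n = 1 the function is x_1 = (1 - \<psi>) / 2, with correlation exactly -1/2. This
  reaches every \<epsilon> < 1/2, and it is separate because x_1 is not orthogonal to \<psi> here,
  unlike the linear terms for n >= 2.\<close>

lemma parity_bump_correlation_one:
  assumes "1 \<le> k"
  shows "(\<Sum>x\<in>cube k. parity_bump 1 x * char_fn 1 x) = - (2 ^ k / 2)"
proof -
  have "parity_bump 1 x * char_fn 1 x = char_fn 1 x / 2 - 1 / 2" if "x \<in> cube k" for x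
  proof -
    have "card (ones 1 x) = 0 \<or> card (ones 1 x) = 1"
      using card_ones_le[of 1 x] by linarith
    then show ?thesis
      using char_fn_ones[OF that assms] by (auto simp: parity_bump_def)
  qed
  then show ?thesis
    using sum_char_fn[OF _ assms]
    by (simp add: sum_subtractf card_cube flip: sum_divide_distrib)
qed

text \<open>Since s mod 2 = (1 - \<psi>) / 2 and \<psi> squares to 1, multiplying n + s + (s mod 2)
  by \<psi> gives (n + 1/2) \<psi> + s \<psi> - 1/2. The first two terms sum to 0 over the cube,
  which leaves the -1/2.\<close>

lemma parity_bump_correlation:
  assumes "2 \<le> n" "n \<le> k"
  shows "(\<Sum>x\<in>cube k. parity_bump n x * char_fn n x) \<le> - (2 ^ k / (2 * real (2 * n + 1)))"
proof -
  let ?\<psi> = "char_fn n"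
  \<comment> \<open>Equality holds unless s = 0. There \<psi> = 1, and the left side is 0 while the
    right side is \<open>n\<close>, so resetting the value to 0 only makes the negative correlation
    stronger.\<close>
  have "real (2 * n + 1) * (parity_bump n x * ?\<psi> x)
      \<le> (real n + 1 / 2) * ?\<psi> x + (\<Sum>i<n. x i * ?\<psi> x) - 1 / 2" if x: "x \<in> cube k" for x
  proof -
    let ?s = "card (ones n x)"
    have lin: "(\<Sum>i<n. x i * ?\<psi> x) = real ?s * ?\<psi> x"
      using card_ones_eq_sum[OF x assms(2)] by (simp add: sum_distrib_right)
    have "real (2 * n + 1) * parity_bump n x = (if ?s = 0 then 0 else real (n + ?s + ?s mod 2))"
      by (simp add: parity_bump_def Let_def)
    then have bump: "real (2 * n + 1) * (parity_bump n x * ?\<psi> x)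
        = (if ?s = 0 then 0 else real (n + ?s + ?s mod 2)) * ?\<psi> x"
      by (simp only: mult.assoc[symmetric])
    show ?thesis
    proof (cases "even ?s")
      case True
      then have "?\<psi> x = 1" using char_fn_ones[OF x assms(2)] by simp
      with True show ?thesis unfolding bump lin by simp
    next
      case False
      then have mod: "?s mod 2 = 1" by presburger
      then have "?\<psi> x = -1" using char_fn_ones[OF x assms(2)] by simp
      moreover have "?s \<noteq> 0" using False by (metis dvd_0_right)
      ultimately show ?thesis unfolding bump lin mod by simp
    qed
  qed
  then have "(\<Sum>x\<in>cube k. real (2 * n + 1) * (parity_bump n x * ?\<psi> x))
      \<le> (\<Sum>x\<in>cube k. (real n + 1 / 2) * ?\<psi> x + (\<Sum>i<n. x i * ?\<psi> x) - 1 / 2)"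
    by (rule sum_mono)
  also have "\<dots> = (real n + 1 / 2) * (\<Sum>x\<in>cube k. ?\<psi> x) + (\<Sum>i<n. \<Sum>x\<in>cube k. x i * ?\<psi> x) - 2 ^ k / 2"
    by (simp add: sum_subtractf sum.distrib sum_distrib_left card_cube sum.swap[of _ "cube k"])
  also have "\<dots> = - (2 ^ k / 2)"
  proof -
    \<comment> \<open>The flipped coordinate must differ from \<open>i\<close>; 0 or 1 serves, and
      both lie below \<open>n\<close> because n >= 2.\<close>
    have "(\<Sum>x\<in>cube k. x i * ?\<psi> x) = 0" for i
      using sum_char_fn_flip_invariant[of "if i = 0 then 1 else 0" n k "\<lambda>x. x i"] assms by auto
    then show ?thesis
      using sum_char_fn[of n k] assms by simp
  qed
  finally have "real (2 * n + 1) * (\<Sum>x\<in>cube k. parity_bump n x * ?\<psi> x) \<le> - (2 ^ k / 2)"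
    by (simp add: sum_distrib_left)
  then show ?thesis
    by (simp add: field_simps)
qed

text \<open>The range \<epsilon> < 1/2 is natural: the constant 1/2 is within 1/2 of every function
  with values in [0,1], so for larger \<epsilon> the degree is 0 and no positive lower bound can
  hold.\<close>

theorem theorem6p8:
  "\<exists>a b c :: real. a > 0 \<and> b > 0 \<and> c > 0 \<and>
     (\<forall>\<epsilon> :: real. 0 < \<epsilon> \<and> \<epsilon> < 1 / 2 \<longrightarrow>
        (\<exists>(k :: nat) (f :: (nat \<Rightarrow> real) \<Rightarrow> real).
           a / \<epsilon>\<^sup>2 \<le> real k \<and> real k \<le> b / \<epsilon>\<^sup>2 \<and>
           xos k f \<and> (\<forall>x\<in>cube k. f x \<in> {0..1}) \<and>
           c / \<epsilon> \<le> real (l2_degree k \<epsilon> f)))"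
proof -
  have "\<exists>k f. 1 / \<epsilon>\<^sup>2 \<le> real k \<and> real k \<le> 2 / \<epsilon>\<^sup>2 \<and> xos k f \<and> (\<forall>x\<in>cube k. f x \<in> {0..1}) \<and>
           (1 / 16) / \<epsilon> \<le> real (l2_degree k \<epsilon> f)" if \<epsilon>: "0 < \<epsilon>" "\<epsilon> < 1 / 2" for \<epsilon> :: real
  proof -
    define y where "y = 1 / \<epsilon>"
    have y: "2 < y" "\<epsilon> = 1 / y" using \<epsilon> by (auto simp: y_def field_simps)
    \<comment> \<open>Rounding up costs less than 1, and 1 <= y^2 because y > 2, so \<open>k\<close>
      stays below 2 y^2.\<close>
    define k where "k = nat \<lceil>y\<^sup>2\<rceil>"
    \<comment> \<open>The factor 1/16 leaves room for the rounding: n < y/16 + 1 gives y > 16 n -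
      16, which is at least 4 n + 2 once n >= 2. This is the condition \<epsilon> < 1 / (2 (2n + 1))
      that the correlation bound requires.\<close>
    define n where "n = nat \<lceil>y / 16\<rceil>"
    have y2: "2 * y < y\<^sup>2" using y by (simp add: power2_eq_square)
    have k: "y\<^sup>2 \<le> real k" "real k < y\<^sup>2 + 1"
      unfolding k_def using y2 y by linarith+
    have n: "y / 16 \<le> real n" "real n < y / 16 + 1"
      unfolding n_def using y by linarith+
    have "1 \<le> n" using n y by linarith
    have "real n \<le> real k" using n k y y2 by linarith
    then have "n \<le> k" by simp
    have "\<epsilon> * 2 ^ k < \<bar>\<Sum>x\<in>cube k. parity_bump n x * char_fn n x\<bar>"
    proof (cases "n = 1")
      case True
      then show ?thesis using parity_bump_correlation_one[of k] \<open>n \<le> k\<close> \<epsilon> by simp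
    next
      case False
      with \<open>1 \<le> n\<close> have n2: "2 \<le> n" by simp
      then have "2 \<le> real n" by simp
    moreover have "16 * real n < y + 16" using n(2) by simp
    ultimately have "4 * real n + 2 < y" by linarith
      then have "1 / y < 1 / (4 * real n + 2)"
        using y by (intro divide_strict_left_mono mult_pos_pos) auto
      then have "\<epsilon> < 1 / (2 * real (2 * n + 1))"
        using y(2) by (simp add: algebra_simps)
      from mult_strict_right_mono[OF this, of "2 ^ k"]
      have "\<epsilon> * 2 ^ k < 2 ^ k / (2 * real (2 * n + 1))" by simp
      then show ?thesis using parity_bump_correlation[OF n2 \<open>n \<le> k\<close>] by linarith
    qed
    then have "n \<le> l2_degree k \<epsilon> (parity_bump n)"
      using \<epsilon> \<open>n \<le> k\<close> by (intro l2_degree_ge) auto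
    then have "(1 / 16) / \<epsilon> \<le> real (l2_degree k \<epsilon> (parity_bump n))"
      using n y by simp
    moreover have "1 / \<epsilon>\<^sup>2 \<le> real k" "real k \<le> 2 / \<epsilon>\<^sup>2"
      using k y y2 by (simp_all add: power_divide)
    ultimately show ?thesis
      using xos_parity_bump[OF \<open>1 \<le> n\<close> \<open>n \<le> k\<close>] parity_bump_range by blast
  qed
  then show ?thesis
    by (intro exI[of _ 1] exI[of _ 2] exI[of _ "1 / 16"]) auto
qed

end
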